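(* Let $n$ and $\Delta$ be positive integers such that $\mathcal{B}(n,\Delta)$ is nonempty, and let $\lambda(n,\Delta)=\max\{\rho(G): G\in\mathcal{B}(n,\Delta)\}$ be the maximum spectral radius among all graphs in $\mathcal{B}(n,\Delta)$. Then $$\Delta-\lambda(n,\Delta)>\frac{2\Delta}{n(4n+\Delta-4)}.$$
   Context: Graphs are finite and simple. The spectral radius $\rho(G)$ of a graph $G$ is the largest eigenvalue of its adjacency matrix. A graph is irregular if its vertices do not all have the same degree. $\mathcal{B}(n,\Delta)$ denotes the set of all connected irregular bipartite graphs on $n$ vertices with maximum degree (exactly) $\Delta$. *)

theory Defs
  imports
    "Graph_Theory.Graph_Theory"
    "Jordan_Normal_Form.Spectral_Radius"
begin

text \<open>
  A finite simple graph is a \<open>pair_graph\<close>: a finite loop-free digraph with a symmetric arc set,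
  each edge \<open>{u, v}\<close> being the two arcs \<open>(u, v)\<close> and \<open>(v, u)\<close>. The degree of a vertex is
  therefore its \<open>out_degree\<close>.
\<close>

definition bipartite :: "'a pair_pre_digraph \<Rightarrow> bool" where
  "bipartite G \<longleftrightarrow>
    (\<exists>U V. pverts G = U \<union> V \<and> U \<inter> V = {} \<and>
      (\<forall>(u, v) \<in> parcs G. u \<in> U \<and> v \<in> V \<or> u \<in> V \<and> v \<in> U))"

definition irregular :: "'a pair_pre_digraph \<Rightarrow> bool" where
  "irregular G \<longleftrightarrow>
    (\<exists>u \<in> pverts G. \<exists>v \<in> pverts G. out_degree (with_proj G) u \<noteq> out_degree (with_proj G) v)"

definition max_degree :: "'a pair_pre_digraph \<Rightarrow> nat" where
  "max_degree G = Max (out_degree (with_proj G) ` pverts G)"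

text \<open>Only meaningful for graphs with vertex set \<open>{..<n}\<close>, where \<open>n\<close> is the number of vertices.\<close>

definition adjacency_mat :: "nat pair_pre_digraph \<Rightarrow> real mat" where
  "adjacency_mat G =
    mat (card (pverts G)) (card (pverts G)) (\<lambda>(i, j). if (i, j) \<in> parcs G then 1 else 0)"

text \<open>
  The largest eigenvalue. The adjacency matrix is real symmetric, so all its eigenvalues are
  real and its spectrum over the reals is the full one. (The constant \<open>spectral_radius\<close> of
  the library is instead the largest modulus of an eigenvalue of a complex matrix.)
\<close>

definition graph_spectral_radius :: "nat pair_pre_digraph \<Rightarrow> real" where
  "graph_spectral_radius G = Max (spectrum (adjacency_mat G))"

text \<open>
  The connected irregular bipartite graphs on \<open>n\<close> vertices with maximum degree \<open>\<Delta>\<close>, as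
  labelled graphs on the vertex set \<open>{..<n}\<close>; every graph on \<open>n\<close> vertices is isomorphic to
  such a graph. \<open>Digraph_Component.connected\<close> excludes the graph without vertices.
\<close>

definition conn_irreg_bip_graphs :: "nat \<Rightarrow> nat \<Rightarrow> nat pair_pre_digraph set" where
  "conn_irreg_bip_graphs n \<Delta> =
    {G. pair_graph G \<and> pverts G = {..<n} \<and> Digraph_Component.connected (with_proj G) \<and>
      irregular G \<and> bipartite G \<and> max_degree G = \<Delta>}"

text \<open>By finiteness, the maximum of the spectral radii is attained
  whenever the set is nonempty.\<close>

lemma finite_conn_irreg_bip_graphs: "finite (conn_irreg_bip_graphs n \<Delta>)"
proof (rule finite_subset)
  show "conn_irreg_bip_graphs n \<Delta> \<subseteq>
    (\<lambda>E. \<lparr>pverts = {..<n}, parcs = E\<rparr>) ` Pow ({..<n} \<times> {..<n})"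
  proof
    fix G assume G: "G \<in> conn_irreg_bip_graphs n \<Delta>"
    then interpret pair_graph G by (simp add: conn_irreg_bip_graphs_def)
    have V: "pverts G = {..<n}" using G by (simp add: conn_irreg_bip_graphs_def)
    have "parcs G \<subseteq> {..<n} \<times> {..<n}"
      using arc_fst_in_verts arc_snd_in_verts V by auto
    moreover have "G = \<lparr>pverts = {..<n}, parcs = parcs G\<rparr>" using V by simp
    ultimately show "G \<in> (\<lambda>E. \<lparr>pverts = {..<n}, parcs = E\<rparr>) ` Pow ({..<n} \<times> {..<n})"
      by blast
  qed
qed simp

definition max_spectral_radius :: "nat \<Rightarrow> nat \<Rightarrow> real" where
  "max_spectral_radius n \<Delta> = Max (graph_spectral_radius ` conn_irreg_bip_graphs n \<Delta>)"

end

theory Submission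
  imports Defs "HOL-Analysis.Convex"
begin

text \<open>
  Let \<open>x\<close> be an eigenvector for any real eigenvalue \<open>l\<close>, let \<open>s\<close> maximise \<open>\<bar>x\<^sub>s\<bar>\<close>, and let \<open>t\<close> be a vertex
  of degree \<open>\<Delta> - c < \<Delta>\<close> at the least possible distance \<open>k\<close> from \<open>s\<close>. In the identity
  \<open>(\<Delta> - l) \<Sum> x\<^sub>v\<^sup>2 = \<Sum> (\<Delta> - d\<^sub>v) x\<^sub>v\<^sup>2 + \<Sum> (x\<^sub>u - x\<^sub>v)\<^sup>2\<close>, the last sum being over the edges, keep only
  the vertex \<open>t\<close> and a shortest path from \<open>s\<close> to \<open>t\<close>. By Cauchy--Schwarz the right-hand side is at
  least \<open>c x\<^sub>s\<^sup>2 / (c k + 1)\<close>, and \<open>\<Sum> x\<^sub>v\<^sup>2 \<le> n x\<^sub>s\<^sup>2\<close>, so \<open>\<Delta> - l \<ge> c / (n (c k + 1))\<close>.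

  It remains to bound \<open>k\<close>. All vertices at distance less than \<open>k\<close> from \<open>s\<close> have degree \<open>\<Delta>\<close>, and
  adjacent vertices have no common neighbour, so two consecutive vertices of the path have \<open>2 \<Delta>\<close>
  neighbours, spread over four consecutive distance levels. Hence \<open>n\<close> is at least about \<open>k \<Delta> / 2\<close>.
  The count obtained this way can be too small only if \<open>c = 1\<close> and \<open>4\<close> divides \<open>k\<close>; in that case
  \<open>t\<close> itself has \<open>\<Delta> - 1\<close> neighbours and is counted as a path vertex too.
\<close>

text \<open>Cauchy--Schwarz for \<open>a = (a - b) + b\<close> with weights \<open>k\<close> and
  \<open>1 / c\<close>, multiplied through by \<open>c\<close>. The case \<open>k = 0\<close> occurs
  when the maximum sits at \<open>t\<close> itself.\<close>

lemma weighted_energy_bound: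
  fixes a b c k P :: real
  assumes "(a - b)\<^sup>2 \<le> k * P" "c \<ge> 0" "k \<ge> 0" "P \<ge> 0"
  shows "c * a\<^sup>2 \<le> (c * k + 1) * (P + c * b\<^sup>2)"
proof -
  have "2 * c * (a - b) * b \<le> P + c\<^sup>2 * k * b\<^sup>2"
  proof (cases "k = 0")
    case True
    then show ?thesis using assms by simp
  next
    case False
    have "0 \<le> ((a - b) - c * k * b)\<^sup>2" by simp
    then have "k * (2 * c * (a - b) * b) \<le> (a - b)\<^sup>2 + (c * k * b)\<^sup>2"
      by (simp add: power2_diff[of "a - b"] mult_ac)
    also have "\<dots> \<le> k * P + (c * k * b)\<^sup>2" using assms(1) by simp
    also have "\<dots> = k * (P + c\<^sup>2 * k * b\<^sup>2)" by (simp add: power2_eq_square algebra_simps)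
    finally show ?thesis using False assms(3) by simp
  qed
  moreover have "c * (a - b)\<^sup>2 \<le> c * (k * P)" using assms by (intro mult_left_mono)
  ultimately show ?thesis by (simp add: power2_eq_square algebra_simps)
qed

section \<open>Distance levels in a rooted graph\<close>

text \<open>Bipartiteness enters the argument as \<open>disjoint_nbhds\<close>, which for
  \<open>u = v\<close> also excludes loops.\<close>

locale rooted_triangle_free_graph =
  fixes V :: "'a set" and E :: "('a \<times> 'a) set" and s :: 'a
  assumes finite_V: "finite V"
    and E_subset: "E \<subseteq> V \<times> V"
    and sym_E: "sym E"
    and disjoint_nbhds: "\<And>u v. (u, v) \<in> E \<Longrightarrow> E `` {u} \<inter> E `` {v} = {}"
    and root_in: "s \<in> V"
    and reachable_root: "\<And>v. v \<in> V \<Longrightarrow> (s, v) \<in> E\<^sup>*"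
begin

definition level :: "'a \<Rightarrow> nat" where
  "level v = (LEAST j. (s, v) \<in> E ^^ j)"

definition ball_size :: "nat \<Rightarrow> nat" where
  "ball_size j = card {v \<in> V. level v \<le> j}"

lemma level_le: "(s, v) \<in> E ^^ j \<Longrightarrow> level v \<le> j"
  unfolding level_def by (rule Least_le)

lemma relpow_level: "v \<in> V \<Longrightarrow> (s, v) \<in> E ^^ level v"
  unfolding level_def using reachable_root[of v] by (auto simp: rtrancl_power intro: LeastI)

lemma level_root: "level s = 0"
  using level_le[of s 0] by simp

lemma level_step: "(u, v) \<in> E \<Longrightarrow> level v \<le> Suc (level u)"
  using relpow_level[of u] E_subset by (intro level_le) auto

lemma level_diff:
  assumes "(u, v) \<in> E"
  shows "level v \<le> Suc (level u)" "level u \<le> Suc (level v)"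
  using assms level_step symD[OF sym_E] by blast+

lemma finite_nbhd: "finite (E `` {u})"
  by (rule finite_subset[OF _ finite_V]) (use E_subset in auto)

lemma loop_free: "(u, u) \<notin> E"
  using disjoint_nbhds[of u u] by auto

text \<open>A walk of length \<open>level t\<close> gains at most one level per step, so it has to
  gain exactly one each time.\<close>

lemma shortest_path:
  assumes "t \<in> V"
  obtains p where "p 0 = s" "p (level t) = t"
    "\<And>i. i < level t \<Longrightarrow> (p i, p (Suc i)) \<in> E"
    "\<And>i. i \<le> level t \<Longrightarrow> level (p i) = i"
    "\<And>i. i \<le> level t \<Longrightarrow> p i \<in> V"
proof -
  obtain p where p: "p 0 = s" "p (level t) = t" "\<forall>i<level t. (p i, p (Suc i)) \<in> E"
    using relpow_level[OF assms] unfolding relpow_fun_conv by blast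
  have up: "level (p i) \<le> i" if "i \<le> level t" for i
    using that
  proof (induction i)
    case 0
    then show ?case using p level_root by simp
  next
    case (Suc i)
    then have "level (p (Suc i)) \<le> Suc (level (p i))" using p by (intro level_step) auto
    then show ?case using Suc by simp
  qed
  have down: "level t \<le> level (p i) + (level t - i)" if "i \<le> level t" for i
    using that
  proof (induction rule: inc_induct)
    case base
    then show ?case using p by simp
  next
    case (step i)
    then have "level (p (Suc i)) \<le> Suc (level (p i))" using p by (intro level_step) auto
    then show ?case using step by simp
  qed
  have "level (p i) = i" if "i \<le> level t" for i
    using up[OF that] down[OF that] that by simp
  moreover have "p i \<in> V" if "i \<le> level t" for i
  proof (cases i)
    case 0
    then show ?thesis using p root_in by simp
  next
    case (Suc j)
    then have "(p j, p i) \<in> E" using p that by auto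
    then show ?thesis using E_subset by auto
  qed
  ultimately show ?thesis using p that by blast
qed

text \<open>The two neighbourhoods are disjoint and lie in the four levels from \<open>level u - 1\<close> to
  \<open>level u + 2\<close>.\<close>

lemma ball_size_pair:
  assumes "(u, v) \<in> E" "level v = Suc (level u)"
  shows "card (E `` {u}) + card (E `` {v}) + card {w \<in> V. level w + 2 \<le> level u}
    \<le> ball_size (level u + 2)"
proof -
  \<comment> \<open>The additive condition makes \<open>?B\<close> empty when
    \<open>level u < 2\<close>; truncated subtraction would still admit \<open>s\<close>.\<close>
  let ?N = "E `` {u} \<union> E `` {v}" and ?B = "{w \<in> V. level w + 2 \<le> level u}"
  have "card (E `` {u}) + card (E `` {v}) = card ?N"
    using disjoint_nbhds[OF assms(1)] by (simp add: card_Un_disjoint finite_nbhd)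
  moreover have "?N \<inter> ?B = {}"
    using level_diff assms(2) by fastforce
  then have "card (?N \<union> ?B) = card ?N + card ?B"
    using finite_V by (intro card_Un_disjoint) (auto simp: finite_nbhd)
  moreover have "level w \<le> level u + 2" if "w \<in> ?N" for w
    using that level_step[of u w] level_step[of v w] assms(2) by auto
  then have "card (?N \<union> ?B) \<le> ball_size (level u + 2)"
    unfolding ball_size_def using E_subset finite_V by (intro card_mono) auto
  ultimately show ?thesis by simp
qed

section \<open>Counting vertices level by level\<close>

lemma ball_size_le_card: "ball_size j \<le> card V"
  unfolding ball_size_def by (rule card_mono) (use finite_V in auto)

lemma ball_size_Suc:
  assumes "v \<in> V" "level v = Suc j"
  shows "ball_size j < ball_size (Suc j)"
  unfolding ball_size_def
proof (rule psubset_card_mono)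
  have "v \<in> {w \<in> V. level w \<le> Suc j} - {w \<in> V. level w \<le> j}" using assms by simp
  then show "{w \<in> V. level w \<le> j} \<subset> {w \<in> V. level w \<le> Suc j}" by fastforce
qed (use finite_V in simp)

lemma card_nbhd_less_order:
  assumes "u \<in> V"
  shows "card (E `` {u}) < card V"
  using assms E_subset loop_free finite_V by (intro psubset_card_mono) auto

lemma ball_size_1: "card (E `` {s}) + 1 \<le> ball_size 1"
proof -
  have "insert s (E `` {s}) \<subseteq> {v \<in> V. level v \<le> 1}"
    using level_root level_step[of s] root_in E_subset by fastforce
  then have "card (insert s (E `` {s})) \<le> ball_size 1"
    unfolding ball_size_def using finite_V by (intro card_mono) auto
  then show ?thesis using loop_free by (simp add: finite_nbhd)
qed

text \<open>This is \<open>2 * D / (4 * card V + D - 4) < c / (c * k + 1)\<close>, multiplied out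
  over the naturals. The vertex \<open>w\<close> gives \<open>D < card V\<close>, which settles
  \<open>k = 0\<close>.\<close>

lemma order_bound:
  fixes t :: 'a and c D :: nat
  defines "k \<equiv> level t"
  assumes t: "t \<in> V" and deg_t: "card (E `` {t}) + c = D" and c: "c \<ge> 1"
    and full: "\<And>v. v \<in> V \<Longrightarrow> level v < k \<Longrightarrow> card (E `` {v}) = D"
    and w: "w \<in> V" "card (E `` {w}) = D"
  shows "2 * D * (c * k + 1) + 4 * c < c * (4 * card V + D)"
proof -
  obtain p where p: "p 0 = s" "p k = t"
    and arc: "\<And>i. i < k \<Longrightarrow> (p i, p (Suc i)) \<in> E"
    and lev: "\<And>i. i \<le> k \<Longrightarrow> level (p i) = i"
    and pV: "\<And>i. i \<le> k \<Longrightarrow> p i \<in> V"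
    using shortest_path[OF t] unfolding k_def by metis
  have deg: "card (E `` {p i}) = D" if "i < k" for i
    using full that lev pV by simp
  have D: "D \<ge> 1" using deg_t c by simp
  have nD: "D < card V" using card_nbhd_less_order[OF w(1)] w(2) by simp
  \<comment> \<open>For \<open>k = 4 * m + 2\<close> the count is strict only because of
    this.\<close>
  have D2: "D \<ge> 2" if "k \<ge> 2"
  proof -
    have e: "(p 1, p 0) \<in> E" "(p 1, p 2) \<in> E"
      using arc[of 0] arc[of 1] that symD[OF sym_E] by (auto simp: numeral_2_eq_2)
    have "p 0 \<noteq> p 2" using lev[of 0] lev[of 2] that by auto
    moreover have "card {p 0, p 2} \<le> card (E `` {p 1})"
      using e by (intro card_mono finite_nbhd) auto
    ultimately show ?thesis using deg[of 1] that by simp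
  qed
  have pair_first: "card (E `` {p i}) + card (E `` {p (Suc i)}) \<le> ball_size (i + 2)" if "i < k" for i
    using ball_size_pair[OF arc[OF that]] lev[of i] lev[of "Suc i"] that by simp
  \<comment> \<open>Four more levels gain two degrees. These are not yet replaced by
    \<open>D\<close>, since \<open>p (i + 3)\<close> may be \<open>t\<close>.\<close>
  have pair: "ball_size i + card (E `` {p (i + 2)}) + card (E `` {p (i + 3)})
      \<le> ball_size (i + 4)" if "i + 2 < k" for i
    using ball_size_pair[OF arc[OF that]] lev[of "i + 2"] lev[of "i + 3"] that
    by (simp add: ball_size_def numeral_eq_Suc)
  have b1: "2 * D * m + D + 1 \<le> ball_size (4 * m + 1)" if "4 * m < k" for m
    using that
  proof (induction m)
    case 0
    then show ?case using ball_size_1 deg[of 0] p by simp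
  next
    case (Suc m)
    then have "2 * D * m + D + 1 \<le> ball_size (4 * m + 1)" by simp
    then show ?case
      using pair[of "4 * m + 1"] deg[of "4 * m + 3"] deg[of "4 * m + 4"] Suc.prems
      by (simp add: numeral_eq_Suc)
  qed
  have b2: "2 * D * m + 2 * D \<le> ball_size (4 * m + 2)" if "4 * m + 1 < k" for m
    using that
  proof (induction m)
    case 0
    then show ?case using pair_first[of 0] deg[of 0] deg[of 1] by simp
  next
    case (Suc m)
    then have "2 * D * m + 2 * D \<le> ball_size (4 * m + 2)" by simp
    then show ?case
      using pair[of "4 * m + 2"] deg[of "4 * m + 4"] deg[of "4 * m + 5"] Suc.prems
      by (simp add: numeral_eq_Suc)
  qed
  \<comment> \<open>For \<open>c >= 2\<close> the first bound suffices because
    \<open>2 * D <= c * D\<close>; for \<open>c = 1\<close> the count must supply a further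
    \<open>D\<close>.\<close>
  have key: "2 * D * k + 4 < 4 * card V \<and> (c = 1 \<longrightarrow> 2 * D * k + D + 4 < 4 * card V)"
  proof -
    define m where "m = k div 4"
    have "k = 4 * m \<or> k = 4 * m + 1 \<or> k = 4 * m + 2 \<or> k = 4 * m + 3"
      unfolding m_def by presburger
    then consider "k = 4 * m" "m = 0" | m' where "k = 4 * m" "m = Suc m'" | "k = 4 * m + 1"
      | "k = 4 * m + 2" | "k = 4 * m + 3"
      by (cases m) auto
    then show ?thesis
    proof cases
      case 1
      then show ?thesis using nD D by simp
    next
      case 2
      then have "2 * D * m \<le> ball_size (4 * m' + 2)" using b2[of m'] by (simp add: algebra_simps)
      \<comment> \<open>The last two levels each contain a path vertex. This yields the first
        bound.\<close>
      moreover have "ball_size (4 * m' + 2) < ball_size (4 * m' + 3)"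
        "ball_size (4 * m' + 3) < ball_size (4 * m' + 4)"
        using ball_size_Suc[OF pV lev, of "4 * m' + 2"]
          ball_size_Suc[OF pV lev, of "4 * m' + 3"] 2
        by (simp_all add: numeral_eq_Suc)
      ultimately have ge: "2 * D * m + 2 \<le> card V" using ball_size_le_card[of "4 * m' + 4"] by simp
      \<comment> \<open>For the bound with \<open>c = 1\<close>, count from \<open>b1\<close>
        instead and end with the pair \<open>p (4 * m' + 3)\<close>, \<open>t\<close>, whose degrees
        sum to \<open>2 * D - c\<close>.\<close>
      have "ball_size (4 * m' + 1) + D + card (E `` {t}) \<le> ball_size (4 * m' + 5)"
        using pair[of "4 * m' + 1"] deg[of "4 * m' + 3"] p(2) 2 by (simp add: numeral_eq_Suc)
      moreover have "2 * D * m' + D + 1 \<le> ball_size (4 * m' + 1)" using b1[of m'] 2 by simp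
      ultimately have "2 * D * m' + 2 * D + 1 + card (E `` {t}) \<le> card V"
        using ball_size_le_card[of "4 * m' + 5"] by linarith
      then have "2 * D * m + D + 1 \<le> card V + c" using deg_t 2 by (simp add: algebra_simps)
      then show ?thesis using ge 2 D2 by (auto simp: algebra_simps)
    next
      case 3
      have "2 * D * m + D + 1 \<le> card V" using b1[of m] ball_size_le_card[of "4 * m + 1"] 3 by simp
      then show ?thesis using 3 D by (simp add: algebra_simps)
    next
      case 4
      have "2 * D * m + 2 * D \<le> card V" using b2[of m] ball_size_le_card[of "4 * m + 2"] 4 by simp
      then show ?thesis using 4 D2 by (simp add: algebra_simps)
    next
      case 5
      have "2 * D * m + 2 * D + 1 \<le> card V"
        using b2[of m] ball_size_Suc[OF pV lev, of "4 * m + 2"]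
          ball_size_le_card[of "4 * m + 3"] 5 by (simp add: numeral_eq_Suc)
      then show ?thesis using 5 D2 by (simp add: algebra_simps)
    qed
  qed
  show ?thesis
  proof (cases "c = 1")
    case True
    then show ?thesis using key by (simp add: algebra_simps)
  next
    case False
    then have "2 * D \<le> c * D" using c by (intro mult_right_mono) auto
    moreover have "c * (2 * D * k + 4) < c * (4 * card V)" using key c by (intro mult_strict_left_mono) auto
    moreover have "2 * D * (c * k + 1) + 4 * c = c * (2 * D * k + 4) + 2 * D"
      "c * (4 * card V + D) = c * (4 * card V) + c * D"
      by (simp_all add: algebra_simps)
    ultimately show ?thesis by linarith
  qed
qed

section \<open>Energy of an eigenvector and the spectral gap\<close>

text \<open>Expand the squares: reversing arcs turns both pure terms into the same degree sum, and
  \<open>eig\<close> evaluates the mixed term. The division by 2 is due to each edge being two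
  arcs.\<close>

lemma quadratic_form_eigenvector:
  fixes x :: "'a \<Rightarrow> real" and l D :: real
  assumes eig: "\<And>v. v \<in> V \<Longrightarrow> (\<Sum>u\<in>E `` {v}. x u) = l * x v"
  shows "(D - l) * (\<Sum>v\<in>V. (x v)\<^sup>2) =
    (\<Sum>v\<in>V. (D - real (card (E `` {v}))) * (x v)\<^sup>2) + (\<Sum>(u, v)\<in>E. (x u - x v)\<^sup>2) / 2"
proof -
  have E: "E = Sigma V (\<lambda>v. E `` {v})" using E_subset by auto
  have sums: "(\<Sum>(u, v)\<in>E. f u v) = (\<Sum>u\<in>V. \<Sum>v\<in>E `` {u}. f u v)" for f :: "'a \<Rightarrow> 'a \<Rightarrow> real"
    by (subst E) (simp add: sum.Sigma finite_V finite_nbhd)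
  have E_swap: "(v, u) \<in> E \<longleftrightarrow> (u, v) \<in> E" for u v using sym_E by (blast dest: symD)
  have swap: "(\<Sum>(u, v)\<in>E. f u v) = (\<Sum>(u, v)\<in>E. f v u)" for f :: "'a \<Rightarrow> 'a \<Rightarrow> real"
    by (intro sum.reindex_bij_witness[of _ prod.swap prod.swap]) (auto simp: E_swap)
  have "(\<Sum>(u, v)\<in>E. (x u - x v)\<^sup>2) =
      (\<Sum>(u, v)\<in>E. (x u)\<^sup>2) + (\<Sum>(u, v)\<in>E. (x v)\<^sup>2) - 2 * (\<Sum>(u, v)\<in>E. x u * x v)"
    by (simp add: power2_diff sum.distrib sum_subtractf sum_distrib_left case_prod_unfold mult.assoc)
  also have "(\<Sum>(u, v)\<in>E. (x v)\<^sup>2) = (\<Sum>(u, v)\<in>E. (x u)\<^sup>2)"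
    by (rule swap)
  also have "(\<Sum>(u, v)\<in>E. (x u)\<^sup>2) = (\<Sum>v\<in>V. real (card (E `` {v})) * (x v)\<^sup>2)"
    by (simp add: sums)
  also have "(\<Sum>(u, v)\<in>E. x u * x v) = (\<Sum>u\<in>V. x u * (l * x u))"
    unfolding sums by (intro sum.cong refl) (simp add: eig flip: sum_distrib_left)
  also have "\<dots> = l * (\<Sum>v\<in>V. (x v)\<^sup>2)"
    by (simp add: sum_distrib_left power2_eq_square mult_ac)
  finally have "(\<Sum>(u, v)\<in>E. (x u - x v)\<^sup>2) =
      2 * (\<Sum>v\<in>V. real (card (E `` {v})) * (x v)\<^sup>2) - 2 * (l * (\<Sum>v\<in>V. (x v)\<^sup>2))"
    by simp
  moreover have "(\<Sum>v\<in>V. (D - real (card (E `` {v}))) * (x v)\<^sup>2) =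
      D * (\<Sum>v\<in>V. (x v)\<^sup>2) - (\<Sum>v\<in>V. real (card (E `` {v})) * (x v)\<^sup>2)"
    by (simp add: left_diff_distrib sum_subtractf sum_distrib_left)
  ultimately show ?thesis
    by (simp add: left_diff_distrib diff_divide_distrib)
qed

text \<open>Telescoping and Cauchy--Schwarz along a shortest path. The factor 2 comes from using
  each path edge in both directions: arcs in \<open>F\<close> raise the level and those in
  \<open>F'\<close> lower it, so none is counted twice.\<close>

lemma path_energy:
  fixes x :: "'a \<Rightarrow> real"
  assumes t: "t \<in> V"
  shows "2 * (x s - x t)\<^sup>2 \<le> real (level t) * (\<Sum>(u, v)\<in>E. (x u - x v)\<^sup>2)"
proof -
  define k where "k = level t"
  obtain p where p: "p 0 = s" "p k = t"
    and arc: "\<And>i. i < k \<Longrightarrow> (p i, p (Suc i)) \<in> E"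
    and lev: "\<And>i. i \<le> k \<Longrightarrow> level (p i) = i"
    using shortest_path[OF t] unfolding k_def by metis
  define y where "y i = x (p i) - x (p (Suc i))" for i
  define F where "F = (\<lambda>i. (p i, p (Suc i))) ` {..<k}"
  define F' where "F' = (\<lambda>i. (p (Suc i), p i)) ` {..<k}"
  have inj: "inj_on (\<lambda>i. (p i, p (Suc i))) {..<k}" "inj_on (\<lambda>i. (p (Suc i), p i)) {..<k}"
    by (rule inj_onI, metis lev lessThan_iff less_imp_le_nat Pair_inject)+
  have up: "level v = Suc (level u)" if "(u, v) \<in> F" for u v
    using that unfolding F_def by (auto simp: lev)
  have down: "level u = Suc (level v)" if "(u, v) \<in> F'" for u v
    using that unfolding F'_def by (auto simp: lev)
  have disj: "F \<inter> F' = {}" using up down by fastforce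
  have "F \<union> F' \<subseteq> E"
    unfolding F_def F'_def using arc symD[OF sym_E] by auto
  then have "(\<Sum>(u, v)\<in>F \<union> F'. (x u - x v)\<^sup>2) \<le> (\<Sum>(u, v)\<in>E. (x u - x v)\<^sup>2)"
    using finite_subset[OF E_subset] finite_V by (intro sum_mono2) auto
  moreover have "(\<Sum>(u, v)\<in>F \<union> F'. (x u - x v)\<^sup>2) =
      (\<Sum>(u, v)\<in>F. (x u - x v)\<^sup>2) + (\<Sum>(u, v)\<in>F'. (x u - x v)\<^sup>2)"
    by (rule sum.union_disjoint) (use disj in \<open>auto simp: F_def F'_def\<close>)
  moreover have "(\<Sum>(u, v)\<in>F. (x u - x v)\<^sup>2) = (\<Sum>i<k. (y i)\<^sup>2)"
    unfolding F_def y_def by (simp add: sum.reindex[OF inj(1)])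
  moreover have "(\<Sum>(u, v)\<in>F'. (x u - x v)\<^sup>2) = (\<Sum>i<k. (y i)\<^sup>2)"
    unfolding F'_def y_def by (simp add: sum.reindex[OF inj(2)] power2_commute)
  ultimately have "2 * (\<Sum>i<k. (y i)\<^sup>2) \<le> (\<Sum>(u, v)\<in>E. (x u - x v)\<^sup>2)" by simp
  then have "real k * (2 * (\<Sum>i<k. (y i)\<^sup>2)) \<le> real k * (\<Sum>(u, v)\<in>E. (x u - x v)\<^sup>2)"
    by (rule mult_left_mono) simp
  moreover have "(\<Sum>i<k. y i) = x s - x t"
    unfolding y_def using sum_lessThan_telescope'[of "\<lambda>i. x (p i)" k] p by simp
  moreover have "(\<Sum>i<k. y i)\<^sup>2 \<le> (\<Sum>i<k. (y i)\<^sup>2) * real k"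
    using sum_squared_le_sum_of_squares[of y "{..<k}"] by simp
  ultimately show ?thesis unfolding k_def by (simp add: mult_ac)
qed

lemma eigenvalue_gap:
  fixes x :: "'a \<Rightarrow> real" and l :: real and c D :: nat
  assumes eig: "\<And>v. v \<in> V \<Longrightarrow> (\<Sum>u\<in>E `` {v}. x u) = l * x v"
    and max: "\<And>v. v \<in> V \<Longrightarrow> \<bar>x v\<bar> \<le> \<bar>x s\<bar>" and nz: "x s \<noteq> 0"
    and deg: "\<And>v. v \<in> V \<Longrightarrow> card (E `` {v}) \<le> D"
    and t: "t \<in> V" and deg_t: "card (E `` {t}) + c = D" and c: "c \<ge> 1"
  shows "real c \<le> (real D - l) * (real (card V) * (real c * real (level t) + 1))"
proof -
  let ?S = "\<Sum>v\<in>V. (x v)\<^sup>2" and ?P = "(\<Sum>(u, v)\<in>E. (x u - x v)\<^sup>2) / 2"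
  let ?m = "real c * real (level t) + 1"
  have P: "?P \<ge> 0" by (auto intro!: sum_nonneg)
  have pos: "(x s)\<^sup>2 > 0" using nz by simp
  have "c * (x t)\<^sup>2 = (D - real (card (E `` {t}))) * (x t)\<^sup>2" using deg_t by auto
  also have "\<dots> \<le> (\<Sum>v\<in>V. (D - real (card (E `` {v}))) * (x v)\<^sup>2)"
    using t deg finite_V by (intro member_le_sum) auto
  finally have "?P + c * (x t)\<^sup>2 \<le> (real D - l) * ?S"
    using quadratic_form_eigenvector[OF eig, of D] by simp
  then have "?m * (?P + c * (x t)\<^sup>2) \<le> ?m * ((real D - l) * ?S)"
    by (intro mult_left_mono) auto
  moreover have "c * (x s)\<^sup>2 \<le> ?m * (?P + c * (x t)\<^sup>2)"
    using weighted_energy_bound[of "x s" "x t" "level t" ?P c] path_energy[OF t, of x] P by simp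
  ultimately have le: "c * (x s)\<^sup>2 \<le> ?m * ((real D - l) * ?S)" by linarith
  \<comment> \<open>The sign of \<open>D - l\<close> must be known before \<open>?S\<close> can be
    replaced by its upper bound; it follows from \<open>le\<close>.\<close>
  have "0 < real c * (x s)\<^sup>2" using c pos by simp
  then have "0 < ?m * ((real D - l) * ?S)" using le by linarith
  then have "0 < (real D - l) * ?S" by (rule zero_less_mult_pos) (simp add: add_nonneg_pos)
  moreover have "0 \<le> ?S" by (intro sum_nonneg) auto
  ultimately have "0 < D - l" by (auto simp: zero_less_mult_iff)
  moreover have "?S \<le> (\<Sum>v\<in>V. (x s)\<^sup>2)" by (intro sum_mono) (use max in \<open>simp add: abs_le_square_iff\<close>)
  ultimately have "?m * ((real D - l) * ?S) \<le> ?m * ((real D - l) * (card V * (x s)\<^sup>2))"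
    by (intro mult_left_mono) auto
  then have "c * (x s)\<^sup>2 \<le> ((real D - l) * (card V * ?m)) * (x s)\<^sup>2" using le by (simp add: mult_ac)
  then show ?thesis using pos by (simp add: mult_ac)
qed

end

section \<open>Existence of a real eigenvalue\<close>

text \<open>Ensures that the \<open>Max\<close> defining the spectral radius is attained. A complex
  eigenvalue exists, the Hermitian form shows that it is real, and the real or imaginary part of its
  eigenvector is a real eigenvector.\<close>

lemma symmetric_real_mat_spectrum_non_empty:
  fixes a :: "nat \<Rightarrow> nat \<Rightarrow> real"
  assumes n: "n > 0" and sym: "\<And>i j. i < n \<Longrightarrow> j < n \<Longrightarrow> a i j = a j i"
  shows "spectrum (mat n n (\<lambda>(i, j). a i j)) \<noteq> {}"
proof -
  let ?A = "mat n n (\<lambda>(i, j). a i j)" and ?B = "mat n n (\<lambda>(i, j). complex_of_real (a i j))"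
  obtain k where "k \<in> spectrum ?B" using spectrum_non_empty[of ?B n] n by auto
  then obtain v where v: "v \<in> carrier_vec n" "v \<noteq> 0\<^sub>v n" "?B *\<^sub>v v = k \<cdot>\<^sub>v v"
    by (auto simp: spectrum_def eigenvalue_def eigenvector_def)
  have eig: "(\<Sum>j<n. of_real (a i j) * v $ j) = k * v $ i" if "i < n" for i
    using arg_cong[OF v(3), of "\<lambda>w. w $ i"] that v(1)
    by (simp add: scalar_prod_def lessThan_atLeast0)
  let ?s = "\<Sum>i<n. \<Sum>j<n. of_real (a i j) * (cnj (v $ i) * v $ j)"
  have "?s = (\<Sum>i<n. cnj (v $ i) * (k * v $ i))"
    by (intro sum.cong refl) (simp add: mult_ac sum_distrib_left flip: eig)
  also have "\<dots> = k * of_real (\<Sum>i<n. (cmod (v $ i))\<^sup>2)"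
    by (simp only: of_real_sum complex_norm_square sum_distrib_left mult_ac)
  finally have s: "?s = k * of_real (\<Sum>i<n. (cmod (v $ i))\<^sup>2)" .
  have "cnj ?s = (\<Sum>i<n. \<Sum>j<n. of_real (a j i) * (cnj (v $ j) * v $ i))"
    by (simp add: mult.commute, intro sum.cong refl, subst sym, auto)
  also have "\<dots> = ?s" by (rule sum.swap)
  finally have cs: "cnj ?s = ?s" .
  obtain i0 where i0: "i0 < n" "v $ i0 \<noteq> 0" using v by (auto simp: vec_eq_iff)
  have "0 < (cmod (v $ i0))\<^sup>2" using i0 by simp
  also have "\<dots> \<le> (\<Sum>i<n. (cmod (v $ i))\<^sup>2)" using i0 by (intro member_le_sum) auto
  finally have "complex_of_real (\<Sum>i<n. (cmod (v $ i))\<^sup>2) \<noteq> 0"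
    unfolding of_real_eq_0_iff by simp
  then have "cnj k = k"
    using cs unfolding s complex_cnj_mult complex_cnj_complex_of_real mult_cancel_right by blast
  then obtain r where r: "k = of_real r" by (metis Reals_cnj_iff Reals_cases)
  \<comment> \<open>\<open>f\<close> stands for \<open>Re\<close> or \<open>Im\<close>; whichever is
    nonzero on entry \<open>i0\<close> gives a nonzero vector.\<close>
  have ev: "r \<in> spectrum ?A" if f: "f (v $ i0) \<noteq> 0" "\<And>s z. f (of_real s * z) = s * f z"
      and lin: "\<And>g. f (\<Sum>j<n. g j) = (\<Sum>j<n. f (g j))" for f :: "complex \<Rightarrow> real"
  proof -
    let ?w = "vec n (\<lambda>i. f (v $ i))"
    have "?A *\<^sub>v ?w = r \<cdot>\<^sub>v ?w"
    proof (rule eq_vecI)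
      fix i assume "i < dim_vec (r \<cdot>\<^sub>v ?w)"
      then have i: "i < n" by simp
      have "(\<Sum>j<n. a i j * f (v $ j)) = f (k * v $ i)" by (simp add: f lin flip: eig[OF i])
      then show "(?A *\<^sub>v ?w) $ i = (r \<cdot>\<^sub>v ?w) $ i"
        using i by (simp add: scalar_prod_def lessThan_atLeast0 r f)
    qed simp
    moreover have "?w \<noteq> 0\<^sub>v n" using f i0 by (auto simp: vec_eq_iff)
    ultimately show ?thesis
      unfolding spectrum_def eigenvalue_def eigenvector_def by (auto intro!: exI[of _ ?w])
  qed
  have "Re (v $ i0) \<noteq> 0 \<or> Im (v $ i0) \<noteq> 0" using i0 by (simp add: complex_eq_iff)
  then show ?thesis using ev[of Re] ev[of Im] by auto
qed

section \<open>Application to connected irregular bipartite graphs\<close>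

lemma graph_spectral_radius_bound:
  assumes "G \<in> conn_irreg_bip_graphs n \<Delta>"
  shows "real \<Delta> - graph_spectral_radius G > 2 * real \<Delta> / (real n * (4 * real n + real \<Delta> - 4))"
proof -
  have V: "pverts G = {..<n}" and pg: "pair_graph G"
    and conn: "Digraph_Component.connected (with_proj G)"
    and irr: "irregular G" and bip: "bipartite G" and Max: "max_degree G = \<Delta>"
    using assms by (auto simp: conn_irreg_bip_graphs_def)
  interpret pair_graph G by (rule pg)
  let ?E = "parcs G" and ?l = "graph_spectral_radius G"
  have E: "?E \<subseteq> {..<n} \<times> {..<n}"
    using arc_fst_in_verts arc_snd_in_verts V by auto
  have sym: "sym ?E" using arcs_symmetric by (auto intro: symI)
  have deg: "out_degree (with_proj G) v = card (?E `` {v})" for v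
  proof -
    have "out_arcs (with_proj G) v = Pair v ` (?E `` {v})" by (auto simp: out_arcs_def)
    then show ?thesis by (simp add: out_degree_def card_image inj_on_def)
  qed
  have "pverts G \<noteq> {}" using irr unfolding irregular_def by blast
  then have n: "n > 0" unfolding V by (cases n) simp_all
  have degs: "card (?E `` {v}) \<le> \<Delta>" if "v < n" for v
    using that V by (auto simp: deg[symmetric] Max[symmetric] max_degree_def)
  have "\<Delta> \<in> out_degree (with_proj G) ` {..<n}"
    unfolding Max[symmetric] max_degree_def V using n by (intro Max_in) auto
  then obtain w where w: "w < n" "card (?E `` {w}) = \<Delta>" by (auto simp: deg)
  obtain t0 where t0: "t0 < n" "card (?E `` {t0}) \<noteq> \<Delta>"
    using irr unfolding irregular_def V deg by auto
  have A: "adjacency_mat G = mat n n (\<lambda>(i, j). if (i, j) \<in> ?E then 1 else 0)"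
    by (simp add: adjacency_mat_def V)
  have "?l \<in> spectrum (adjacency_mat G)"
    unfolding graph_spectral_radius_def
  proof (rule Max_in)
    show "finite (spectrum (adjacency_mat G))"
      by (rule card_finite_spectrum(1)[of _ n]) (simp add: A)
    show "spectrum (adjacency_mat G) \<noteq> {}"
      unfolding A using n symD[OF sym]
      by (intro symmetric_real_mat_spectrum_non_empty[of n "\<lambda>i j. if (i, j) \<in> ?E then 1 else 0"]) auto
  qed
  then obtain x where x: "x \<in> carrier_vec n" "x \<noteq> 0\<^sub>v n" "adjacency_mat G *\<^sub>v x = ?l \<cdot>\<^sub>v x"
    by (auto simp: spectrum_def eigenvalue_def eigenvector_def A)
  have eig: "(\<Sum>u\<in>?E `` {v}. x $ u) = ?l * x $ v" if v: "v < n" for v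
  proof -
    have "{..<n} \<inter> {j. (v, j) \<in> ?E} = ?E `` {v}" using E by auto
    then have "(\<Sum>u\<in>?E `` {v}. x $ u) = (\<Sum>j<n. (if (v, j) \<in> ?E then 1 else 0) * x $ j)"
      by (simp add: if_distrib[of "\<lambda>z. z * _"] sum.If_cases cong: if_cong)
    also have "\<dots> = ?l * x $ v"
      using arg_cong[OF x(3), of "\<lambda>y. y $ v"] v x(1)
      by (simp add: A scalar_prod_def lessThan_atLeast0)
    finally show ?thesis .
  qed
  obtain s where s: "s < n" and smax: "\<And>v. v < n \<Longrightarrow> \<bar>x $ v\<bar> \<le> \<bar>x $ s\<bar>"
  proof -
    have "Max ((\<lambda>v. \<bar>x $ v\<bar>) ` {..<n}) \<in> (\<lambda>v. \<bar>x $ v\<bar>) ` {..<n}" using n by (intro Max_in) auto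
    then obtain s where "s < n" "Max ((\<lambda>v. \<bar>x $ v\<bar>) ` {..<n}) = \<bar>x $ s\<bar>" by auto
    moreover have "\<bar>x $ v\<bar> \<le> Max ((\<lambda>v. \<bar>x $ v\<bar>) ` {..<n})" if "v < n" for v
      using that by (intro Max_ge) auto
    ultimately show ?thesis using that by metis
  qed
  obtain i where "i < n" "x $ i \<noteq> 0" using x by (auto simp: vec_eq_iff)
  then have nz: "x $ s \<noteq> 0" using smax[of i] by auto
  obtain A B where disj: "A \<inter> B = {}"
    and bip: "\<forall>(u, v) \<in> ?E. u \<in> A \<and> v \<in> B \<or> u \<in> B \<and> v \<in> A"
    using bip unfolding bipartite_def by blast
  have AB: "u \<in> A \<and> v \<in> B \<or> u \<in> B \<and> v \<in> A" if "(u, v) \<in> ?E" for u v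
    using bspec[OF bip that] by simp
  interpret rooted_triangle_free_graph "{..<n}" ?E s
  proof
    show "?E `` {u} \<inter> ?E `` {v} = {}" if "(u, v) \<in> ?E" for u v
    proof (rule ccontr)
      \<comment> \<open>A common neighbour would form a triangle, but its three vertices cannot
        alternate between two sides.\<close>
      assume "\<not> ?thesis"
      then obtain w where "(u, w) \<in> ?E" "(v, w) \<in> ?E" by blast
      from disj AB[OF that] this[THEN AB] show False by auto
    qed
    show "(s, v) \<in> ?E\<^sup>*" if "v \<in> {..<n}" for v
    proof -
      \<comment> \<open>Connectedness refers to the symmetric closure, which has the same
        reachability because the arcs are already symmetric.\<close>
      have "strongly_connected (mk_symmetric (with_proj G))"
        using conn unfolding Digraph_Component.connected_def .
      moreover have "s \<in> verts (mk_symmetric (with_proj G))"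
        "v \<in> verts (mk_symmetric (with_proj G))"
        using that s by (simp_all add: V)
      ultimately have "s \<rightarrow>\<^sup>*\<^bsub>mk_symmetric (with_proj G)\<^esub> v"
        unfolding strongly_connected_def by blast
      then have "s \<rightarrow>\<^sup>*\<^bsub>with_proj G\<^esub> v"
        by (simp only: reachable_mk_symmetric_eq[OF pair_sym_arcs])
      then have "(s, v) \<in> (arcs_ends (with_proj G))\<^sup>*" by (rule reachable_rtranclI)
      then show ?thesis by simp
    qed
  qed (use E sym s in auto)
  \<comment> \<open>Taking a deficient vertex nearest to \<open>s\<close> makes all lower levels
    have full degree.\<close>
  define t where "t = arg_min_on level {v. v < n \<and> card (?E `` {v}) \<noteq> \<Delta>}"
  have "t \<in> {v. v < n \<and> card (?E `` {v}) \<noteq> \<Delta>}"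
    unfolding t_def by (rule arg_min_if_finite) (use t0 in auto)
  then have t: "t < n" "card (?E `` {t}) \<noteq> \<Delta>" by auto
  have full: "card (?E `` {v}) = \<Delta>" if "v < n" "level v < level t" for v
    using that arg_min_least[of "{v. v < n \<and> card (?E `` {v}) \<noteq> \<Delta>}" v level]
    unfolding t_def[symmetric] by fastforce
  define c where "c = \<Delta> - card (?E `` {t})"
  have c: "c \<ge> 1" "card (?E `` {t}) + c = \<Delta>" using t degs[of t] by (auto simp: c_def)
  let ?m = "real c * real (level t) + 1" and ?d = "4 * real n + real \<Delta> - 4"
  have gap: "real c \<le> (\<Delta> - ?l) * (n * ?m)"
    using eigenvalue_gap[of "\<lambda>v. x $ v" ?l \<Delta> t c] eig smax nz degs t c by simp
  have "2 * \<Delta> * (c * level t + 1) + 4 * c < c * (4 * n + \<Delta>)"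
    using order_bound[of t c \<Delta> w] t c full w by simp
  then have "real (2 * \<Delta> * (c * level t + 1) + 4 * c) < real (c * (4 * n + \<Delta>))"
    by (simp only: of_nat_less_iff)
  then have order: "2 * real \<Delta> * ?m < real c * ?d" by (simp add: algebra_simps)
  \<comment> \<open>Here \<open>4 * n >= 4\<close>, and the maximum degree is at least
    \<open>c >= 1\<close>.\<close>
  have d: "0 < ?d" using n c by simp
  have m: "0 < ?m" by (simp add: add_nonneg_pos)
  have "2 * real \<Delta> / ?d < real c / ?m"
    using order by (simp only: pos_less_divide_eq[OF m] pos_divide_less_eq[OF d] times_divide_eq_left)
  then have "2 * real \<Delta> / ?d / n < real c / ?m / n"
    using n by (intro divide_strict_right_mono) auto
  then have "2 * real \<Delta> / (n * ?d) < real c / (n * ?m)"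
    by (simp only: divide_divide_eq_left mult.commute)
  also have "\<dots> \<le> \<Delta> - ?l"
    using gap mult_pos_pos[OF _ m, of n] n by (subst pos_divide_le_eq) (auto simp: mult_ac)
  finally show ?thesis .
qed

theorem theorem1p7:
  fixes n \<Delta> :: nat
  assumes "n > 0" and "\<Delta> > 0"
    and "conn_irreg_bip_graphs n \<Delta> \<noteq> {}"
  shows "real \<Delta> - max_spectral_radius n \<Delta>
    > 2 * real \<Delta> / (real n * (4 * real n + real \<Delta> - 4))"
proof -
  have "max_spectral_radius n \<Delta> \<in> graph_spectral_radius ` conn_irreg_bip_graphs n \<Delta>"
    unfolding max_spectral_radius_def
    using assms(3) finite_conn_irreg_bip_graphs by (intro Max_in) auto
  then show ?thesis using graph_spectral_radius_bound by auto
qed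

end
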